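(* Consider the parallel-links routing game with homogeneous costs described in the context, and suppose that $PoA=\hat J_{sys}/J^*_{sys}>1$. Then: (1) the $N$-player bargaining problem $(\mathcal G,\hat{\mathbf J})$ is essential, i.e., there exists $\mathbf g\in\mathcal G$ with $g^i<\hat J^i$ for every $i\in\mathcal N$; (2) the Nash Bargaining Solution $\tilde{\mathbf g}$ satisfies $\tilde g^i<\hat J^i$ for every $i\in\mathcal N$, and consequently $PoS<PoA$.
   Context: Parallel-links routing game: users $\mathcal N=\{1,\dots,N\}$ share parallel links $\mathcal L=\{1,\dots,L\}$ joining a common source to a common destination; link $l$ has capacity $c_l$. User $i$ has demand $r^i>0$, $R=\sum_i r^i$, and $\sum_l c_l>R$. A routing strategy of user $i$ is $\mathbf f^i=(f^i_1,\dots,f^i_L)$ with $f^i_l\ge 0$ and $\sum_l f^i_l=r^i$; a feasible profile is $\mathbf f=(\mathbf f^1,\dots,\mathbf f^N)$ of such strategies (set $\mathbf F$), and $f_l=\sum_i f^i_l$. Homogeneous costs: $J^i(\mathbf f)=\sum_{l} f^i_l T_l(f_l)$, where each $T_l:[0,\infty)\to[0,\infty)$ is strictly increasing, convex and continuously differentiable, and $T_l(f_l)=T(c_l-f_l)$ if $f_l<c_l$, $T_l(f_l)=\infty$ if $f_l\ge c_l$, for a single function $T$ not depending on the link, with $T(c_l-f_l)$ strictly increasing in $f_l$. Nash equilibrium (NEP): a feasible $\hat{\mathbf f}$ such that for every $i$, $\hat{\mathbf f}^i$ minimizes $J^i$ over user $i$'s feasible strategies when the others play $\hat{\mathbf f}^{j}$,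 $j\neq i$; in this game the NEP exists and is unique. Write $\hat J^i=J^i(\hat{\mathbf f})$, $\hat{\mathbf J}=(\hat J^1,\dots,\hat J^N)$, $\hat J_{sys}=\sum_i\hat J^i$. Social cost: $J_{sys}(\mathbf f)=\sum_i J^i(\mathbf f)=\sum_l f_lT_l(f_l)$; $J^*_{sys}$ is its minimum over $\mathbf F$. $PoA=\hat J_{sys}/J^*_{sys}$. Bargaining: $\mathcal G$ is the set of all vectors $\sum_{m=1}^M p_m\,(J^1(\mathbf f(m)),\dots,J^N(\mathbf f(m)))$ with $M$ finite, $p_m>0$, $\sum_m p_m=1$, $\mathbf f(m)\in\mathbf F$. The Nash Bargaining Solution (NBS) with disagreement point $\hat{\mathbf J}$ is the unique $\tilde{\mathbf g}$ maximizing $\prod_{i=1}^N(\hat J^i-g^i)$ over $\mathbf g\in\mathcal G$ with $g^i\le\hat J^i$ for all $i$. The Price of Selfishness is $PoS=\big(\sum_i\tilde g^i\big)/J^*_{sys}$. *)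

theory Defs
  imports "HOL-Analysis.Analysis"
begin

text \<open>Users are indexed by 0..<N, links by 0..<L. A routing profile is
  f :: nat => nat => real, where f i l is the flow of user i on link l.
  Costs are extended reals (ereal) because T_l(x) = infinity for x >= c_l.\<close>

definition link_cost :: "(nat \<Rightarrow> real) \<Rightarrow> (real \<Rightarrow> real) \<Rightarrow> nat \<Rightarrow> real \<Rightarrow> ereal" where
  "link_cost c T l x = (if x < c l then ereal (T (c l - x)) else \<infinity>)"

definition link_flow :: "nat \<Rightarrow> (nat \<Rightarrow> nat \<Rightarrow> real) \<Rightarrow> nat \<Rightarrow> real" where
  "link_flow N f l = (\<Sum>i<N. f i l)"

definition user_cost ::
  "nat \<Rightarrow> nat \<Rightarrow> (nat \<Rightarrow> real) \<Rightarrow> (real \<Rightarrow> real) \<Rightarrow> (nat \<Rightarrow> nat \<Rightarrow> real) \<Rightarrow> nat \<Rightarrow> ereal" where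
  "user_cost N L c T f i = (\<Sum>l<L. ereal (f i l) * link_cost c T l (link_flow N f l))"

definition feasible_strategy :: "nat \<Rightarrow> (nat \<Rightarrow> real) \<Rightarrow> nat \<Rightarrow> (nat \<Rightarrow> real) \<Rightarrow> bool" where
  "feasible_strategy L r i s \<longleftrightarrow> (\<forall>l<L. 0 \<le> s l) \<and> (\<Sum>l<L. s l) = r i"

definition feasible_profile :: "nat \<Rightarrow> nat \<Rightarrow> (nat \<Rightarrow> real) \<Rightarrow> (nat \<Rightarrow> nat \<Rightarrow> real) \<Rightarrow> bool" where
  "feasible_profile N L r f \<longleftrightarrow> (\<forall>i<N. feasible_strategy L r i (f i))"

definition is_NEP ::
  "nat \<Rightarrow> nat \<Rightarrow> (nat \<Rightarrow> real) \<Rightarrow> (real \<Rightarrow> real) \<Rightarrow> (nat \<Rightarrow> real) \<Rightarrow> (nat \<Rightarrow> nat \<Rightarrow> real) \<Rightarrow> bool" where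
  "is_NEP N L c T r fh \<longleftrightarrow> feasible_profile N L r fh \<and>
     (\<forall>i<N. \<forall>s. feasible_strategy L r i s \<longrightarrow>
        user_cost N L c T fh i \<le> user_cost N L c T (fh(i := s)) i)"

definition sys_cost ::
  "nat \<Rightarrow> nat \<Rightarrow> (nat \<Rightarrow> real) \<Rightarrow> (real \<Rightarrow> real) \<Rightarrow> (nat \<Rightarrow> nat \<Rightarrow> real) \<Rightarrow> ereal" where
  "sys_cost N L c T f = (\<Sum>i<N. user_cost N L c T f i)"

definition opt_sys_cost ::
  "nat \<Rightarrow> nat \<Rightarrow> (nat \<Rightarrow> real) \<Rightarrow> (real \<Rightarrow> real) \<Rightarrow> (nat \<Rightarrow> real) \<Rightarrow> ereal" where
  "opt_sys_cost N L c T r = (INF f \<in> {f. feasible_profile N L r f}. sys_cost N L c T f)"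

text \<open>The bargaining set G: finite convex combinations (positive weights) of
  cost vectors of feasible profiles. Only coordinates i < N are meaningful.\<close>
definition bargaining_set ::
  "nat \<Rightarrow> nat \<Rightarrow> (nat \<Rightarrow> real) \<Rightarrow> (real \<Rightarrow> real) \<Rightarrow> (nat \<Rightarrow> real) \<Rightarrow> (nat \<Rightarrow> ereal) set" where
  "bargaining_set N L c T r = {g. \<exists>(M::nat) p fs. M > 0 \<and> (\<forall>m<M. p m > (0::real)) \<and> (\<Sum>m<M. p m) = 1 \<and>
       (\<forall>m<M. feasible_profile N L r (fs m)) \<and>
       (\<forall>i<N. g i = (\<Sum>m<M. ereal (p m) * user_cost N L c T (fs m) i))}"

definition is_NBS :: "nat \<Rightarrow> (nat \<Rightarrow> ereal) set \<Rightarrow> (nat \<Rightarrow> ereal) \<Rightarrow> (nat \<Rightarrow> ereal) \<Rightarrow> bool" where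
  "is_NBS N G d gt \<longleftrightarrow> gt \<in> G \<and> (\<forall>i<N. gt i \<le> d i) \<and>
     (\<forall>g\<in>G. (\<forall>i<N. g i \<le> d i) \<longrightarrow> (\<Prod>i<N. d i - g i) \<le> (\<Prod>i<N. d i - gt i))"

definition C1_on :: "(real \<Rightarrow> real) \<Rightarrow> real set \<Rightarrow> bool" where
  "C1_on h S \<longleftrightarrow> (\<exists>D. (\<forall>x\<in>S. (h has_real_derivative D x) (at x within S)) \<and> continuous_on S D)"

end

theory Submission
  imports Defs
begin

text \<open>Let \<open>v l\<close> be the cost per unit of flow on link \<open>l\<close> at the equilibrium and \<open>\<mu> i\<close> the marginal
  cost of user \<open>i\<close>. The equilibrium conditions turn the marginal social cost of a link into
  \<open>v l + (\<Sum>i<N. max 0 (\<mu> i - v l))\<close>. This expression does not increase with \<open>v l\<close> as long as \<open>l\<close>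
  is used, so, the equilibrium not being socially optimal, a link \<open>a\<close> of least unit cost has larger
  marginal social cost than some link \<open>b\<close>. With \<open>t = v b - v a > 0\<close> and
  \<open>w i = min (\<mu> i - v a) t > 0\<close> this says \<open>t < (\<Sum>i<N. w i)\<close>. If every user \<open>i\<close> moves \<open>e * w i\<close>
  units of flow from \<open>a\<close> to \<open>b\<close>, the cost of user \<open>i\<close> has derivative \<open>w i * (t - (\<Sum>j<N. w j)) < 0\<close>
  at \<open>e = 0\<close>, so all users gain. The Nash product is then positive at its maximum, which makes
  every user gain strictly.\<close>

section \<open>The game and its link costs\<close>

locale parallel_links =
  fixes N L :: nat and c r :: "nat \<Rightarrow> real" and T :: "real \<Rightarrow> real"
    and D :: "nat \<Rightarrow> real \<Rightarrow> real"
  assumes cap_pos: "l < L \<Longrightarrow> 0 < c l"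
    and dem_pos: "i < N \<Longrightarrow> 0 < r i"
    and cap_exceeds: "(\<Sum>i<N. r i) < (\<Sum>l<L. c l)"
    and T_nonneg: "l < L \<Longrightarrow> x \<in> {0..<c l} \<Longrightarrow> 0 \<le> T (c l - x)"
    and T_incr: "l < L \<Longrightarrow> strict_mono_on {0..<c l} (\<lambda>x. T (c l - x))"
    and T_convex: "l < L \<Longrightarrow> convex_on {0..<c l} (\<lambda>x. T (c l - x))"
    and T_deriv: "l < L \<Longrightarrow> x \<in> {0..<c l} \<Longrightarrow>
      ((\<lambda>x. T (c l - x)) has_real_derivative D l x) (at x within {0..<c l})"
begin

definition V :: "nat \<Rightarrow> real \<Rightarrow> real" where
  "V l x = T (c l - x)"

text \<open>These are the feasible profiles in which all users have finite cost
  (\<open>user_cost_within_cap\<close>, \<open>within_capI\<close>). On them \<open>cost\<close> is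
  the real value of \<open>user_cost\<close>, so calculus can be done in the reals.\<close>

definition within_cap :: "(nat \<Rightarrow> nat \<Rightarrow> real) \<Rightarrow> bool" where
  "within_cap f \<longleftrightarrow> feasible_profile N L r f \<and> (\<forall>l<L. link_flow N f l < c l)"

definition cost :: "(nat \<Rightarrow> nat \<Rightarrow> real) \<Rightarrow> nat \<Rightarrow> real" where
  "cost f i = (\<Sum>l<L. f i l * V l (link_flow N f l))"

lemma L_pos: "0 < L"
proof (rule ccontr)
  assume "\<not> 0 < L"
  moreover have "0 \<le> (\<Sum>i<N. r i)" using dem_pos by (intro sum_nonneg) (simp add: less_imp_le)
  ultimately show False using cap_exceeds by simp
qed

lemma V_mono: "l < L \<Longrightarrow> 0 \<le> x \<Longrightarrow> x \<le> y \<Longrightarrow> y < c l \<Longrightarrow> V l x \<le> V l y"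
  using strict_mono_on_imp_mono_on[OF T_incr, of l] by (auto simp: V_def mono_on_def)

text \<open>Convexity gives the tangent bound at interior points; the boundary point 0 is treated
  separately in \<open>marginal_cost_tangent\<close>.\<close>

lemma V_tangent:
  assumes "l < L" "0 < x" "x < c l" "0 \<le> y" "y < c l"
  shows "D l x * (y - x) \<le> V l y - V l x"
proof -
  have "x \<in> interior {0..<c l}" using assms by simp
  then show ?thesis
    using convex_on_imp_above_tangent[OF T_convex[OF assms(1)] _ _ _ T_deriv[OF assms(1)], of x y] assms
    by (simp add: V_def)
qed

text \<open>Strict monotonicity alone allows isolated zeros of the derivative; convexity excludes
  them, since the tangent at \<open>x\<close> evaluated at 0 gives
  \<open>D l x * x \<ge> V l x - V l 0 > 0\<close>.\<close>

lemma D_pos: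
  assumes "l < L" "0 < x" "x < c l"
  shows "0 < D l x"
proof -
  have "V l 0 < V l x"
    using strict_mono_onD[OF T_incr[OF assms(1)], of 0 x] assms by (simp add: V_def)
  then have "0 < D l x * x" using V_tangent[of l x 0] assms by simp
  then show ?thesis using assms by (simp add: zero_less_mult_iff)
qed

text \<open>The slope is the derivative of \<open>x * V l x\<close>, the social cost of a link, so
  this is the first-order form of its convexity. It later certifies social optimality.\<close>

lemma marginal_cost_tangent:
  assumes "l < L" "0 \<le> x" "x < c l" "0 \<le> y" "y < c l"
  shows "(V l x + x * D l x) * (y - x) \<le> y * V l y - x * V l x"
proof (cases "x = 0")
  case True
  then show ?thesis using V_mono[of l 0 y] assms by (simp add: mult.commute mult_left_mono)
next
  case False
  then have "0 < x" using assms by simp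
  have "y * (D l x * (y - x)) \<le> y * (V l y - V l x)"
    using V_tangent[OF assms(1) \<open>0 < x\<close>] assms by (intro mult_left_mono) auto
  \<comment> \<open>The right side minus the left is
    \<open>y * (V l y - V l x - D l x * (y - x))\<close> plus this square term.\<close>
  moreover have "0 \<le> D l x * (y - x)\<^sup>2" using D_pos[OF assms(1) \<open>0 < x\<close>] assms by simp
  ultimately show ?thesis by (simp add: algebra_simps power2_eq_square)
qed

section \<open>Feasible profiles and finite costs\<close>

lemma feasible_nonneg: "feasible_profile N L r f \<Longrightarrow> i < N \<Longrightarrow> l < L \<Longrightarrow> 0 \<le> f i l"
  by (simp add: feasible_profile_def feasible_strategy_def)

lemma feasible_sum: "feasible_profile N L r f \<Longrightarrow> i < N \<Longrightarrow> (\<Sum>l<L. f i l) = r i"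
  by (simp add: feasible_profile_def feasible_strategy_def)

lemma flow_nonneg: "feasible_profile N L r f \<Longrightarrow> l < L \<Longrightarrow> 0 \<le> link_flow N f l"
  unfolding link_flow_def by (intro sum_nonneg) (simp add: feasible_nonneg)

lemma flow_le: "feasible_profile N L r f \<Longrightarrow> i < N \<Longrightarrow> l < L \<Longrightarrow> f i l \<le> link_flow N f l"
  unfolding link_flow_def by (rule member_le_sum) (auto simp: feasible_nonneg)

lemma sum_flow: "feasible_profile N L r f \<Longrightarrow> (\<Sum>l<L. link_flow N f l) = (\<Sum>i<N. r i)"
  unfolding link_flow_def by (subst sum.swap) (simp add: feasible_sum)

lemma used_link:
  assumes "feasible_profile N L r f" "i < N"
  obtains l where "l < L" "0 < f i l"
proof -
  have "0 < (\<Sum>l<L. f i l)" using assms dem_pos by (simp add: feasible_sum)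
  then obtain l where "l < L" "0 < f i l"
    by (metis lessThan_iff linorder_not_less sum_nonpos)
  then show ?thesis by (rule that)
qed

lemma link_cost_nonneg: "l < L \<Longrightarrow> 0 \<le> x \<Longrightarrow> 0 \<le> link_cost c T l x"
  using T_nonneg[of l x] by (simp add: link_cost_def)

lemma user_cost_term_nonneg:
  "feasible_profile N L r f \<Longrightarrow> i < N \<Longrightarrow> l < L \<Longrightarrow>
    0 \<le> ereal (f i l) * link_cost c T l (link_flow N f l)"
  by (simp add: feasible_nonneg link_cost_nonneg flow_nonneg)

lemma user_cost_nonneg: "feasible_profile N L r f \<Longrightarrow> i < N \<Longrightarrow> 0 \<le> user_cost N L c T f i"
  unfolding user_cost_def by (intro sum_nonneg) (simp add: user_cost_term_nonneg)

lemma user_cost_within_cap: "within_cap f \<Longrightarrow> user_cost N L c T f i = ereal (cost f i)"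
  by (simp add: within_cap_def user_cost_def cost_def link_cost_def V_def flip: sum_ereal)

lemma sys_cost_within_cap: "within_cap f \<Longrightarrow> sys_cost N L c T f = ereal (\<Sum>i<N. cost f i)"
  by (simp add: sys_cost_def user_cost_within_cap)

text \<open>A link filled to its positive capacity carries flow of some user, and that user pays
  infinity.\<close>

lemma within_capI:
  assumes f: "feasible_profile N L r f" and fin: "\<And>i. i < N \<Longrightarrow> user_cost N L c T f i \<noteq> \<infinity>"
  shows "within_cap f"
proof -
  have "link_flow N f l < c l" if l: "l < L" for l
  proof (rule ccontr)
    assume *: "\<not> link_flow N f l < c l"
    then have "0 < (\<Sum>i<N. f i l)" using cap_pos[OF l] by (simp add: link_flow_def)
    then obtain i where i: "i < N" "0 < f i l"
      by (metis lessThan_iff linorder_not_less sum_nonpos)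
    then have "ereal (f i l) * link_cost c T l (link_flow N f l) = \<infinity>"
      using * by (simp add: link_cost_def)
    then have "user_cost N L c T f i = \<infinity>"
      unfolding user_cost_def using l by (force simp: sum_Pinfty)
    then show False using fin[OF i(1)] by simp
  qed
  then show ?thesis using f by (simp add: within_cap_def)
qed

text \<open>A user filling the positive residual capacities proportionally has finite cost; links
  saturated by the others receive no flow and cost \<open>0 * \<infinity> = 0\<close>.\<close>
lemma NEP_within_cap:
  assumes NEP: "is_NEP N L c T r f"
  shows "within_cap f"
proof (rule within_capI)
  show f: "feasible_profile N L r f" using NEP by (simp add: is_NEP_def)
  fix i assume i: "i < N"
  \<comment> \<open>\<open>b l\<close> is the capacity left by the other users. It is negative where
    they overload the link; truncating at 0 only increases the total, which thus still exceeds
    \<open>r i\<close>.\<close>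
  define b where "b l = c l - (\<Sum>j\<in>{..<N} - {i}. f j l)" for l
  define B where "B = (\<Sum>l<L. max 0 (b l))"
  define s where "s l = r i * max 0 (b l) / B" for l
  have "(\<Sum>l<L. \<Sum>j\<in>{..<N} - {i}. f j l) = (\<Sum>j\<in>{..<N} - {i}. r j)"
    by (subst sum.swap) (use f in \<open>simp add: feasible_sum\<close>)
  also have "\<dots> = (\<Sum>j<N. r j) - r i" using i by (simp add: sum_diff1)
  finally have "r i < (\<Sum>l<L. b l)" using cap_exceeds by (simp add: b_def sum_subtractf)
  also have "\<dots> \<le> B" unfolding B_def by (intro sum_mono) simp
  finally have rB: "r i < B" .
  have ri: "0 < r i" using dem_pos[OF i] .
  have "feasible_strategy L r i s"
    using ri rB by (auto simp: feasible_strategy_def s_def B_def[symmetric]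
        simp flip: sum_distrib_left sum_divide_distrib)
  then have le: "user_cost N L c T f i \<le> user_cost N L c T (f(i := s)) i"
    using NEP i by (simp add: is_NEP_def)
  have flow: "link_flow N (f(i := s)) l = c l - b l + s l" for l
    using i by (simp add: link_flow_def b_def sum.remove[of "{..<N}" i])
  have "ereal (s l) * link_cost c T l (link_flow N (f(i := s)) l) \<noteq> \<infinity>" for l
  proof (cases "0 < b l")
    case True
    then have "s l < b l" using rB ri by (simp add: s_def divide_less_eq)
    then show ?thesis by (simp add: flow link_cost_def)
  next
    case False
    then show ?thesis by (simp add: s_def zero_ereal_def[symmetric])
  qed
  then have "user_cost N L c T (f(i := s)) i \<noteq> \<infinity>"
    by (simp add: user_cost_def sum_Pinfty)
  then show "user_cost N L c T f i \<noteq> \<infinity>" using le by auto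
qed

section \<open>Moving flow from one link to another\<close>

definition dir :: "nat \<Rightarrow> nat \<Rightarrow> nat \<Rightarrow> real" where
  "dir a b l = of_bool (l = b) - of_bool (l = a)"

definition shift ::
  "(nat \<Rightarrow> nat \<Rightarrow> real) \<Rightarrow> nat \<Rightarrow> nat \<Rightarrow> (nat \<Rightarrow> real) \<Rightarrow> real \<Rightarrow> nat \<Rightarrow> nat \<Rightarrow> real" where
  "shift f a b w e i l = f i l + e * w i * dir a b l"

lemma sum_dir:
  assumes "a < L" "b < L"
  shows "(\<Sum>l<L. h l * dir a b l) = h b - h a"
  using assms by (simp add: dir_def right_diff_distrib sum_subtractf of_bool_def
      if_distrib[of "(*) _"] cong: if_cong)

lemma flow_shift:
  "link_flow N (shift f a b w e) l = link_flow N f l + e * ((\<Sum>i<N. w i) * dir a b l)"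
  by (simp add: link_flow_def shift_def sum.distrib sum_distrib_left sum_distrib_right mult.assoc)

text \<open>Every user who gives up flow has some on \<open>a\<close>, and \<open>b\<close> has
  spare capacity, so small moves are admissible. A whole interval is needed as the domain of a
  one-sided derivative.\<close>

lemma shift_within_cap:
  assumes f: "within_cap f" and ab: "a < L" "b < L" "a \<noteq> b"
    and w: "\<And>i. i < N \<Longrightarrow> 0 \<le> w i" "\<And>i. i < N \<Longrightarrow> 0 < w i \<Longrightarrow> 0 < f i a"
  obtains \<delta> where "0 < \<delta>" "\<And>e. e \<in> {0..\<delta>} \<Longrightarrow> within_cap (shift f a b w e)"
proof -
  let ?W = "\<Sum>i<N. w i"
  have fe: "feasible_profile N L r f" using f by (simp add: within_cap_def)
  have W: "0 \<le> ?W" using w by (intro sum_nonneg) auto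
  have "\<forall>\<^sub>F e in at_right 0. e * w i \<le> f i a" if i: "i < N" for i
  proof (cases "w i = 0")
    case True
    then show ?thesis using feasible_nonneg[OF fe i ab(1)] by simp
  next
    case False
    then have "0 < f i a" using w(1)[OF i] w(2)[OF i] by simp
    moreover have "((\<lambda>e. e * w i) \<longlongrightarrow> 0 * w i) (at_right 0)" by (intro tendsto_intros)
    ultimately have "\<forall>\<^sub>F e in at_right 0. e * w i < f i a" by (simp add: order_tendstoD(2))
    then show ?thesis by (rule eventually_mono) simp
  qed
  then have "\<forall>\<^sub>F e in at_right 0. \<forall>i\<in>{..<N}. e * w i \<le> f i a"
    by (intro eventually_ball_finite) auto
  moreover have "\<forall>\<^sub>F e in at_right 0. link_flow N f b + e * ?W < c b"
  proof -
    have "((\<lambda>e. link_flow N f b + e * ?W) \<longlongrightarrow> link_flow N f b + 0 * ?W) (at_right 0)"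
      by (intro tendsto_intros)
    then show ?thesis using f ab by (simp add: order_tendstoD(2) within_cap_def)
  qed
  moreover have "\<forall>\<^sub>F e in at_right (0::real). 0 < e" by (rule eventually_at_right_less)
  ultimately have "\<forall>\<^sub>F e in at_right 0. (\<forall>i\<in>{..<N}. e * w i \<le> f i a) \<and>
      link_flow N f b + e * ?W < c b \<and> 0 < e"
    by eventually_elim simp
  \<comment> \<open>One admissible step size suffices: both bounds are monotone in \<open>e\<close>,
    so they hold on all of \<open>{0..\<delta>}\<close>.\<close>
  from eventually_happens[OF this] obtain \<delta> where
    \<delta>: "\<And>i. i < N \<Longrightarrow> \<delta> * w i \<le> f i a" "link_flow N f b + \<delta> * ?W < c b" "0 < \<delta>"
    by auto
  show ?thesis
  proof (rule that[OF \<delta>(3)])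
    fix e assume e: "e \<in> {0..\<delta>}"
    have "0 \<le> shift f a b w e i l" if "i < N" "l < L" for i l
    proof -
      have "e * w i \<le> f i a"
        using \<delta>(1)[OF that(1)] mult_right_mono[of e \<delta> "w i"] e w(1)[OF that(1)] by simp
      then show ?thesis using e w(1)[OF that(1)] feasible_nonneg[OF fe that] ab
        by (auto simp: shift_def dir_def)
    qed
    moreover have "(\<Sum>l<L. shift f a b w e i l) = r i" if "i < N" for i
      using sum_dir[OF ab(1,2), of "\<lambda>_. e * w i"] feasible_sum[OF fe that]
      by (simp add: shift_def sum.distrib)
    moreover have "link_flow N (shift f a b w e) l < c l" if l: "l < L" for l
    proof -
      have "e * ?W \<le> \<delta> * ?W" using e W by (intro mult_right_mono) auto
      moreover have "0 \<le> e * ?W" using e W by simp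
      moreover have "link_flow N f l < c l" using f l by (simp add: within_cap_def)
      ultimately show ?thesis using \<delta>(2) ab by (auto simp: flow_shift dir_def)
    qed
    ultimately show "within_cap (shift f a b w e)"
      by (simp add: within_cap_def feasible_profile_def feasible_strategy_def)
  qed
qed

text \<open>The quantity in \<open>neg\<close> is the derivative at \<open>e = 0\<close> of the cost
  of user \<open>i\<close> along the shift. The conclusion is an "eventually" so that finitely many
  users can share one \<open>e\<close>.\<close>

lemma shift_decreases_cost:
  assumes f: "within_cap f" and ab: "a < L" "b < L" "a \<noteq> b"
    and w: "\<And>i. i < N \<Longrightarrow> 0 \<le> w i" "\<And>i. i < N \<Longrightarrow> 0 < w i \<Longrightarrow> 0 < f i a"
    and neg: "w i * (V b (link_flow N f b) - V a (link_flow N f a)) +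
      (\<Sum>j<N. w j) * (f i b * D b (link_flow N f b) - f i a * D a (link_flow N f a)) < 0"
  shows "\<forall>\<^sub>F e in at_right 0. within_cap (shift f a b w e) \<and> cost (shift f a b w e) i < cost f i"
proof -
  let ?W = "\<Sum>j<N. w j" and ?F = "link_flow N f"
  obtain \<delta> where \<delta>: "0 < \<delta>" "\<And>e. e \<in> {0..\<delta>} \<Longrightarrow> within_cap (shift f a b w e)"
    using shift_within_cap[of f a b w] f ab w by blast
  have V: "((\<lambda>e. V l (?F l + e * (?W * dir a b l))) has_real_derivative
      D l (?F l) * (?W * dir a b l)) (at 0 within {0..\<delta>})" if l: "l < L" for l
  proof -
    \<comment> \<open>At zero flow the link cost has only a one-sided derivative. The chain rule is
      therefore applied within the image of the path, which feasibility keeps inside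
      \<open>{0..<c l}\<close>.\<close>
    define g where "g e = ?F l + e * (?W * dir a b l)" for e
    have g: "g ` {0..\<delta>} \<subseteq> {0..<c l}"
    proof
      fix x assume "x \<in> g ` {0..\<delta>}"
      then obtain e where e: "e \<in> {0..\<delta>}" "x = link_flow N (shift f a b w e) l"
        by (auto simp: g_def flow_shift)
      then show "x \<in> {0..<c l}"
        using \<delta>(2)[OF e(1)] l by (auto simp: within_cap_def flow_nonneg)
    qed
    have "g 0 \<in> {0..<c l}" using f l by (simp add: g_def within_cap_def flow_nonneg)
    then have "(V l has_real_derivative D l (g 0)) (at (g 0) within g ` {0..\<delta>})"
      using DERIV_subset[OF T_deriv[OF l] g] by (simp add: V_def[abs_def])
    moreover have "(g has_real_derivative (?W * dir a b l)) (at 0 within {0..\<delta>})"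
      unfolding g_def by (auto intro!: derivative_eq_intros)
    ultimately have "(V l \<circ> g has_real_derivative D l (g 0) * (?W * dir a b l)) (at 0 within {0..\<delta>})"
      by (rule DERIV_image_chain)
    then show ?thesis by (simp add: g_def o_def)
  qed
  define \<phi> where
    "\<phi> e = (\<Sum>l<L. (f i l + e * w i * dir a b l) * V l (?F l + e * (?W * dir a b l)))" for e
  \<comment> \<open>By the product rule, summand \<open>l\<close> of \<open>\<phi>\<close> has
    derivative \<open>h l * dir a b l\<close>; \<open>sum_dir\<close> reduces the sum to
    \<open>h b - h a\<close>.\<close>
  define h where "h l = w i * V l (?F l) + ?W * (f i l * D l (?F l))" for l
  have \<phi>_cost: "\<phi> e = cost (shift f a b w e) i" for e
    unfolding \<phi>_def cost_def flow_shift by (simp add: shift_def)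
  have \<phi>0: "\<phi> 0 = cost f i" by (simp add: \<phi>_def cost_def)
  have "(\<phi> has_real_derivative (\<Sum>l<L. h l * dir a b l)) (at 0 within {0..\<delta>})"
    unfolding \<phi>_def
    by (rule DERIV_sum) (auto intro!: derivative_eq_intros V simp: h_def algebra_simps)
  moreover have "(\<Sum>l<L. h l * dir a b l) < 0"
    unfolding sum_dir[OF ab(1,2), of h] using neg by (simp add: h_def algebra_simps)
  ultimately obtain d where d: "0 < d" "\<And>e. 0 < e \<Longrightarrow> e \<in> {0..\<delta>} \<Longrightarrow> e < d \<Longrightarrow> \<phi> e < \<phi> 0"
    using has_real_derivative_neg_dec_right[of \<phi> _ 0 "{0..\<delta>}"] by auto
  show ?thesis
    unfolding eventually_at_right_field
    using d \<delta> by (intro exI[of _ "min d \<delta>"]) (auto simp: \<phi>_cost[symmetric] \<phi>0[symmetric])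
qed

section \<open>Equilibrium conditions\<close>

lemma NEP_KKT:
  assumes NEP: "is_NEP N L c T r f" and i: "i < N" and ab: "a < L" "b < L" and pos: "0 < f i a"
  shows "V a (link_flow N f a) + f i a * D a (link_flow N f a) \<le>
         V b (link_flow N f b) + f i b * D b (link_flow N f b)"
proof (rule ccontr)
  assume *: "\<not> ?thesis"
  \<comment> \<open>Only user \<open>i\<close> moves flow, so the derivative is the difference of
    that user's marginal costs on \<open>b\<close> and \<open>a\<close>, negative by
    assumption.\<close>
  define w :: "nat \<Rightarrow> real" where "w j = of_bool (j = i)" for j
  have W: "(\<Sum>j<N. w j) = 1" using i by (simp add: w_def of_bool_def)
  have f: "within_cap f" using NEP by (rule NEP_within_cap)
  have "\<forall>\<^sub>F e in at_right 0. within_cap (shift f a b w e) \<and> cost (shift f a b w e) i < cost f i"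
    by (rule shift_decreases_cost) (use f ab pos * W in \<open>auto simp: w_def\<close>)
  from eventually_happens[OF this] obtain e where
    e: "within_cap (shift f a b w e)" "cost (shift f a b w e) i < cost f i" by auto
  have eq: "shift f a b w e = f(i := shift f a b w e i)" by (intro ext) (simp add: shift_def w_def)
  have "feasible_strategy L r i (shift f a b w e i)"
    using e(1) i by (simp add: within_cap_def feasible_profile_def)
  then have "user_cost N L c T f i \<le> user_cost N L c T (f(i := shift f a b w e i)) i"
    using NEP i by (auto simp: is_NEP_def)
  then show False
    using e(2) by (simp add: eq[symmetric] user_cost_within_cap[OF f] user_cost_within_cap[OF e(1)])
qed

lemma total_cost: "(\<Sum>i<N. cost f i) = (\<Sum>l<L. link_flow N f l * V l (link_flow N f l))"
  unfolding cost_def by (subst sum.swap) (simp add: link_flow_def sum_distrib_right)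

text \<open>Take \<open>\<mu> i\<close> to be the least marginal cost of user \<open>i\<close>.
  Links used by \<open>i\<close> attain it by \<open>NEP_KKT\<close>, and on the others
  \<open>V\<close> is at least \<open>\<mu> i\<close>; the \<open>max\<close> merges both cases.
  Strictness on used links comes from \<open>D_pos\<close>.\<close>

lemma NEP_multipliers:
  assumes NEP: "is_NEP N L c T r f"
  obtains \<mu> where
    "\<And>i l. i < N \<Longrightarrow> l < L \<Longrightarrow>
      f i l * D l (link_flow N f l) = max 0 (\<mu> i - V l (link_flow N f l))"
    "\<And>i l. i < N \<Longrightarrow> l < L \<Longrightarrow> 0 < f i l \<Longrightarrow> V l (link_flow N f l) < \<mu> i"
proof -
  let ?F = "link_flow N f"
  define m where "m i l = V l (?F l) + f i l * D l (?F l)" for i l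
  define \<mu> where "\<mu> i = Min (m i ` {..<L})" for i
  have f: "within_cap f" using NEP by (rule NEP_within_cap)
  then have fe: "feasible_profile N L r f" by (simp add: within_cap_def)
  have le: "\<mu> i \<le> m i l" if "l < L" for i l
    unfolding \<mu>_def using that by simp
  have eq: "\<mu> i = m i l" if "i < N" "l < L" "0 < f i l" for i l
    unfolding \<mu>_def using NEP_KKT[OF NEP that(1,2) _ that(3)] that by (intro Min_eqI) (auto simp: m_def)
  have pos: "0 < f i l * D l (?F l)" if "i < N" "l < L" "0 < f i l" for i l
    using that flow_le[OF fe that(1,2)] f D_pos[OF that(2), of "?F l"] by (auto simp: within_cap_def)
  show ?thesis
  proof (rule that[of \<mu>])
    fix i l assume il: "i < N" "l < L"
    show "f i l * D l (?F l) = max 0 (\<mu> i - V l (?F l))"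
    proof (cases "0 < f i l")
      case True
      then show ?thesis using eq[OF il] pos[OF il] by (simp add: m_def)
    next
      case False
      then have "f i l = 0" using feasible_nonneg[OF fe il] by simp
      then show ?thesis using le[OF il(2), of i] by (simp add: m_def)
    qed
    show "V l (?F l) < \<mu> i" if "0 < f i l"
      using eq[OF il that] pos[OF il that] by (simp add: m_def)
  qed
qed

section \<open>A deviation improving every user\<close>

lemma NEP_improvable:
  assumes NEP: "is_NEP N L c T r f"
    and y: "within_cap y" "(\<Sum>i<N. cost y i) < (\<Sum>i<N. cost f i)"
  obtains g where "within_cap g" "\<And>i. i < N \<Longrightarrow> cost g i < cost f i"
proof -
  let ?F = "link_flow N f" and ?Y = "link_flow N y"
  define v where "v l = V l (?F l)" for l
  obtain \<mu> where
    fD: "\<And>i l. i < N \<Longrightarrow> l < L \<Longrightarrow> f i l * D l (?F l) = max 0 (\<mu> i - v l)" and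
    used: "\<And>i l. i < N \<Longrightarrow> l < L \<Longrightarrow> 0 < f i l \<Longrightarrow> v l < \<mu> i"
    unfolding v_def using NEP_multipliers[OF NEP] by blast
  have f: "within_cap f" using NEP by (rule NEP_within_cap)
  then have fe: "feasible_profile N L r f" by (simp add: within_cap_def)
  have ye: "feasible_profile N L r y" using y by (simp add: within_cap_def)
  define mc where "mc l = v l + (\<Sum>i<N. max 0 (\<mu> i - v l))" for l
  have mc: "mc l = V l (?F l) + ?F l * D l (?F l)" if "l < L" for l
  proof -
    have "(\<Sum>i<N. max 0 (\<mu> i - v l)) = (\<Sum>i<N. f i l * D l (?F l))"
      using fD[OF _ that] by (intro sum.cong) auto
    also have "\<dots> = ?F l * D l (?F l)" by (simp add: link_flow_def sum_distrib_right)
    finally show ?thesis by (simp add: mc_def v_def)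
  qed
  have "{..<L} \<noteq> {}" using L_pos by auto
  from ex_is_arg_min_if_finite[OF finite_lessThan this, of v]
  obtain a where a: "a < L" "\<And>l. l < L \<Longrightarrow> v a \<le> v l"
    by (auto simp: is_arg_min_linorder)
  \<comment> \<open>Some user \<open>k\<close> on \<open>l\<close> has
    \<open>v a \<le> v l < \<mu> k\<close>, so the unit cost plus the term of \<open>k\<close>
    equals \<open>\<mu> k\<close> on both links; the remaining terms can only grow as the unit cost
    drops to \<open>v a\<close>.\<close>
  have mc_used: "mc l \<le> mc a" if l: "l < L" and pos: "?F l \<noteq> 0" for l
  proof -
    have "0 < (\<Sum>i<N. f i l)" using flow_nonneg[OF fe l] pos by (simp add: link_flow_def)
    then obtain k where k: "k < N" "0 < f k l"
      by (metis lessThan_iff linorder_not_less sum_nonpos)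
    have "(\<Sum>i\<in>{..<N}-{k}. max 0 (\<mu> i - v l)) \<le> (\<Sum>i\<in>{..<N}-{k}. max 0 (\<mu> i - v a))"
      using a(2)[OF l] by (intro sum_mono) auto
    moreover have "v l < \<mu> k" by (rule used) (use k l in auto)
    ultimately show ?thesis
      using k a(2)[OF l] by (simp add: mc_def sum.remove[of "{..<N}" k])
  qed
  \<comment> \<open>Otherwise all used links have marginal social cost \<open>mc a\<close> and no
    link has less. By convexity \<open>f\<close> would then be socially optimal, contradicting
    \<open>y\<close>.\<close>
  have "\<exists>b<L. mc b < mc a"
  proof (rule ccontr)
    assume "\<not> ?thesis"
    then have ge: "mc a \<le> mc l" if "l < L" for l using that by (meson not_less)
    have "(\<Sum>l<L. mc a * (?Y l - ?F l)) \<le> (\<Sum>l<L. mc l * (?Y l - ?F l))"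
    proof (rule sum_mono)
      fix l assume "l \<in> {..<L}"
      then have l: "l < L" by simp
      show "mc a * (?Y l - ?F l) \<le> mc l * (?Y l - ?F l)"
      proof (cases "?F l = 0")
        case True
        then show ?thesis using ge[OF l] flow_nonneg[OF ye l] by (simp add: mult_right_mono)
      next
        case False
        then show ?thesis using ge[OF l] mc_used[OF l] by simp
      qed
    qed
    moreover have "(\<Sum>l<L. mc a * (?Y l - ?F l)) = 0"
      using sum_flow[OF fe] sum_flow[OF ye] by (simp add: sum_subtractf flip: sum_distrib_left)
    moreover have "(\<Sum>l<L. mc l * (?Y l - ?F l)) \<le> (\<Sum>l<L. ?Y l * V l (?Y l) - ?F l * V l (?F l))"
      using f y fe ye
      by (intro sum_mono) (auto simp: mc within_cap_def intro!: marginal_cost_tangent flow_nonneg)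
    ultimately show False using y(2) by (simp add: total_cost sum_subtractf)
  qed
  then obtain b where b: "b < L" "mc b < mc a" by blast
  have u: "v a < \<mu> i" if "i < N" for i
    using used_link[OF fe that] used[OF that] a(2) by (metis order.strict_trans1)
  define t where "t = v b - v a"
  \<comment> \<open>By \<open>w_eq\<close>, \<open>w i\<close> is exactly the drop of
    \<open>f i l * D l (link_flow N f l)\<close> from \<open>a\<close> to \<open>b\<close>. This
    makes the derivative for user \<open>i\<close> factor as \<open>w i * (t - W)\<close>, with the
    same sign for all users.\<close>
  define w where "w i = min (\<mu> i - v a) t" for i
  define W where "W = (\<Sum>i<N. w i)"
  \<comment> \<open>\<open>mc l\<close> depends on \<open>l\<close> only through
    \<open>v l\<close>.\<close>
  have "v a \<noteq> v b" using b(2) by (auto simp: mc_def)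
  then have t: "0 < t" using a(2)[OF b(1)] by (simp add: t_def)
  have w_eq: "w i = max 0 (\<mu> i - v a) - max 0 (\<mu> i - v b)" if "i < N" for i
    using u[OF that] t by (auto simp: w_def t_def)
  have w_pos: "0 < w i" if "i < N" for i using u[OF that] t by (simp add: w_def)
  \<comment> \<open>So \<open>t < W\<close> merely restates \<open>mc b < mc a\<close>.\<close>
  have "W = mc a - mc b + t"
    unfolding W_def using w_eq by (simp add: mc_def t_def sum_subtractf)
  then have tW: "t < W" using b(2) by simp
  have fa: "0 < f i a" if "i < N" for i
    using fD[OF that a(1)] u[OF that] feasible_nonneg[OF fe that a(1)] by (cases "f i a = 0") auto
  have "\<forall>\<^sub>F e in at_right 0. within_cap (shift f a b w e) \<and> cost (shift f a b w e) i < cost f i"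
    if i: "i < N" for i
  proof (rule shift_decreases_cost)
    have gain: "f i b * D b (?F b) - f i a * D a (?F a) = - w i"
      using w_eq[OF i] fD[OF i a(1)] fD[OF i b(1)] by simp
    have "w i * (v b - v a) + W * (f i b * D b (?F b) - f i a * D a (?F a)) = w i * (t - W)"
      unfolding gain t_def by (simp add: algebra_simps)
    also have "\<dots> < 0" using w_pos[OF i] tW by (simp add: mult_pos_neg)
    finally show "w i * (V b (?F b) - V a (?F a)) +
        (\<Sum>j<N. w j) * (f i b * D b (?F b) - f i a * D a (?F a)) < 0"
      by (simp add: W_def v_def)
  qed (use f a(1) b w_pos fa \<open>v a \<noteq> v b\<close> in \<open>auto simp: less_imp_le\<close>)
  moreover have "N \<noteq> 0" using y(2) by (cases N) auto
  ultimately have "\<forall>\<^sub>F e in at_right 0. \<forall>i\<in>{..<N}.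
      within_cap (shift f a b w e) \<and> cost (shift f a b w e) i < cost f i"
    by (intro eventually_ball_finite) auto
  from eventually_happens[OF this] obtain e where
    e: "\<And>i. i < N \<Longrightarrow> within_cap (shift f a b w e) \<and> cost (shift f a b w e) i < cost f i"
    by auto
  show ?thesis
    using e \<open>N \<noteq> 0\<close> by (intro that[of "shift f a b w e"]) auto
qed

section \<open>Bargaining set and Nash product\<close>

lemma user_cost_in_bargaining_set:
  assumes "feasible_profile N L r f"
  shows "user_cost N L c T f \<in> bargaining_set N L c T r"
  unfolding bargaining_set_def mem_Collect_eq
  by (rule exI[of _ 1], rule exI[of _ "\<lambda>_. 1"], rule exI[of _ "\<lambda>_. f"])
    (use assms in \<open>simp add: one_ereal_def[symmetric]\<close>)

text \<open>With the finite disagreement point as upper bound, this makes the coordinates of the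
  bargaining solution finite.\<close>

lemma bargaining_set_nonneg:
  assumes "g \<in> bargaining_set N L c T r" "i < N"
  shows "0 \<le> g i"
proof -
  obtain M p fs where *: "\<forall>m<M. p m > (0::real)" "\<forall>m<M. feasible_profile N L r (fs m)"
    "\<forall>i<N. g i = (\<Sum>m<(M::nat). ereal (p m) * user_cost N L c T (fs m) i)"
    using assms unfolding bargaining_set_def by blast
  have "0 \<le> (\<Sum>m<M. ereal (p m) * user_cost N L c T (fs m) i)"
    by (rule sum_nonneg) (use * assms in \<open>simp add: user_cost_nonneg less_imp_le\<close>)
  then show ?thesis using * assms by simp
qed

end

text \<open>A user without gain would make the Nash product 0, whereas \<open>g\<close> makes it
  positive.\<close>

lemma NBS_less_disagreement:
  assumes NBS: "is_NBS N G d gt" and g: "g \<in> G" "\<And>i. i < N \<Longrightarrow> g i < d i"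
    and fin: "\<And>i. i < N \<Longrightarrow> \<bar>d i\<bar> \<noteq> \<infinity>" and i: "i < N"
  shows "gt i < d i"
proof (rule ccontr)
  assume "\<not> gt i < d i"
  then have "gt i = d i" using NBS i by (auto simp: is_NBS_def not_less intro: antisym)
  \<comment> \<open>Finiteness matters: in \<open>ereal\<close>, infinity minus infinity is not
    0.\<close>
  then have "d i - gt i = 0" using fin[OF i] by (cases "d i") (auto simp: zero_ereal_def)
  then have zero: "(\<Prod>i<N. d i - gt i) = 0" using i by (auto simp: prod_ereal_0)
  have pos: "0 < d j - g j" if "j < N" for j
    using g(2)[OF that] fin[OF that] by (cases "d j"; cases "g j") auto
  have "(\<Prod>i<N. d i - g i) \<le> 0"
    using NBS g zero by (auto simp: is_NBS_def less_imp_le)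
  moreover have "0 \<le> (\<Prod>i<N. d i - g i)"
    by (rule prod_ereal_pos) (use pos in \<open>auto simp: less_imp_le\<close>)
  ultimately have "(\<Prod>i<N. d i - g i) = 0" by (rule antisym)
  then show False using pos by (force simp: prod_ereal_0)
qed

theorem theorem3p1:
  fixes N L :: nat and c r :: "nat \<Rightarrow> real" and T :: "real \<Rightarrow> real"
    and fh :: "nat \<Rightarrow> nat \<Rightarrow> real" and gt :: "nat \<Rightarrow> ereal"
  assumes cap_pos: "\<forall>l<L. c l > 0"
    and dem_pos: "\<forall>i<N. r i > 0"
    and cap_exceeds: "(\<Sum>l<L. c l) > (\<Sum>i<N. r i)"
    and T_nonneg: "\<forall>l<L. \<forall>x\<in>{0..<c l}. T (c l - x) \<ge> 0"
    and T_incr: "\<forall>l<L. strict_mono_on {0..<c l} (\<lambda>x. T (c l - x))"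
    and T_convex: "\<forall>l<L. convex_on {0..<c l} (\<lambda>x. T (c l - x))"
    and T_C1: "\<forall>l<L. C1_on (\<lambda>x. T (c l - x)) {0..<c l}"
    and NEP: "is_NEP N L c T r fh"
    and PoA_gt_1: "real_of_ereal (sys_cost N L c T fh) / real_of_ereal (opt_sys_cost N L c T r) > 1"
    and NBS: "is_NBS N (bargaining_set N L c T r) (user_cost N L c T fh) gt"
  shows "(\<exists>g\<in>bargaining_set N L c T r. \<forall>i<N. g i < user_cost N L c T fh i)
     \<and> (\<forall>i<N. gt i < user_cost N L c T fh i)
     \<and> real_of_ereal (\<Sum>i<N. gt i) / real_of_ereal (opt_sys_cost N L c T r)
         < real_of_ereal (sys_cost N L c T fh) / real_of_ereal (opt_sys_cost N L c T r)"
proof -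
  have "\<exists>D. \<forall>l<L. \<forall>x\<in>{0..<c l}.
      ((\<lambda>x. T (c l - x)) has_real_derivative D l x) (at x within {0..<c l})"
    using T_C1 unfolding C1_on_def by metis
  then obtain D where D: "\<And>l x. l < L \<Longrightarrow> x \<in> {0..<c l} \<Longrightarrow>
      ((\<lambda>x. T (c l - x)) has_real_derivative D l x) (at x within {0..<c l})"
    by blast
  interpret parallel_links N L c r T D
    using cap_pos dem_pos cap_exceeds T_nonneg T_incr T_convex D by unfold_locales auto
  let ?S = "sys_cost N L c T fh" and ?O = "opt_sys_cost N L c T r"
  have fh: "within_cap fh" using NEP by (rule NEP_within_cap)
  have sys_nonneg: "0 \<le> sys_cost N L c T f" if "feasible_profile N L r f" for f
    unfolding sys_cost_def by (intro sum_nonneg) (use that in \<open>simp add: user_cost_nonneg\<close>)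
  have "0 \<le> ?O" unfolding opt_sys_cost_def by (rule INF_greatest) (simp add: sys_nonneg)
  \<comment> \<open>Division by 0 yields 0 and \<open>real_of_ereal\<close> sends infinities to 0,
    so a ratio above 1 forces the optimum to be finite and nonzero.\<close>
  moreover have "real_of_ereal ?O \<noteq> 0" using PoA_gt_1 by auto
  ultimately have O: "0 < real_of_ereal ?O" by (simp add: order_less_le real_of_ereal_pos)
  then have "real_of_ereal ?O < real_of_ereal ?S" using PoA_gt_1 by (simp add: less_divide_eq)
  then have "?O < ?S"
    using O by (cases ?O) (auto simp: sys_cost_within_cap[OF fh])
  \<comment> \<open>A value strictly above the infimum is undercut by some feasible profile, which
    plays the role of the social optimum.\<close>
  then obtain y where y: "feasible_profile N L r y" "sys_cost N L c T y < ?S"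
    unfolding opt_sys_cost_def INF_less_iff by auto
  have "within_cap y"
  proof (rule within_capI[OF y(1)])
    fix i assume "i < N"
    moreover have "sys_cost N L c T y \<noteq> \<infinity>" using y(2) by auto
    ultimately show "user_cost N L c T y i \<noteq> \<infinity>" by (auto simp: sys_cost_def sum_Pinfty)
  qed
  then obtain g where g: "within_cap g" "\<And>i. i < N \<Longrightarrow> cost g i < cost fh i"
    using NEP_improvable[OF NEP] y(2) by (auto simp: sys_cost_within_cap fh)
  have ess: "user_cost N L c T g \<in> bargaining_set N L c T r"
    "\<And>i. i < N \<Longrightarrow> user_cost N L c T g i < user_cost N L c T fh i"
    using g user_cost_in_bargaining_set[of g] fh by (simp_all add: user_cost_within_cap within_cap_def[of g])
  have lt: "gt i < user_cost N L c T fh i" if "i < N" for i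
    by (rule NBS_less_disagreement[OF NBS ess _ that]) (simp_all add: user_cost_within_cap[OF fh])
  define h where "h i = real_of_ereal (gt i)" for i
  have h: "gt i = ereal (h i)" "h i < cost fh i" if "i < N" for i
  proof -
    have "0 \<le> gt i" using NBS that by (auto simp: is_NBS_def intro: bargaining_set_nonneg)
    then show "gt i = ereal (h i)" "h i < cost fh i"
      using lt[OF that] by (cases "gt i"; simp add: h_def user_cost_within_cap[OF fh])+
  qed
  have "N \<noteq> 0" using y(2) by (cases N) (auto simp: sys_cost_def)
  then have "(\<Sum>i<N. h i) < (\<Sum>i<N. cost fh i)" using h(2) by (intro sum_strict_mono) auto
  moreover have "(\<Sum>i<N. gt i) = ereal (\<Sum>i<N. h i)" using h(1) by simp
  ultimately have "real_of_ereal (\<Sum>i<N. gt i) < real_of_ereal ?S"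
    by (simp add: sys_cost_within_cap[OF fh])
  then have "real_of_ereal (\<Sum>i<N. gt i) / real_of_ereal ?O < real_of_ereal ?S / real_of_ereal ?O"
    using O by (rule divide_strict_right_mono)
  then show ?thesis using ess lt by blast
qed

end
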